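(* For every integer $n\ge 1$, the map $\alpha$ (defined in the context) is a bijection from $S_n(213)$ to $S_n(231)$.
   Context: $S_n$ is the set of permutations $\pi=\pi_1\cdots\pi_n$ (one-line notation) of $[n]=\{1,\dots,n\}$. A permutation (of any finite set of integers, written as a word using each element once) contains a pattern $\sigma\in S_k$ if some (not necessarily contiguous) subsequence of length $k$ is order isomorphic to $\sigma$; otherwise it is $\sigma$-avoiding. $S_n(\sigma)$ is the set of $\sigma$-avoiding permutations in $S_n$. The map $\phi$: let $S=\{s_1<\cdots<s_m\}$ and $T=\{t_1<\cdots<t_m\}$ be $m$-element sets of integers and let $\pi$ be a permutation of $S$. If $m=0$, $\phi(\pi,T)$ is the empty word. Otherwise let $\pi_i=s_1$ and write $\pi=\pi'\,\pi_i\,\pi''$ ($\pi',\pi''$ possibly empty). Put $T_1=\{t_1,\dots,t_{m-i}\}$ and $T_2=\{t_{m-i+1},\dots,t_{m-1}\}$ ($T_2=\emptyset$ if $i=1$, $T_1=\emptyset$ if $i=m$). Define recursively $\phi(\pi,T)=\phi(\pi'',T_1)\,t_m\,\phi(\pi',T_2)$, a permutation of $T$. The map $\alpha$: for $\pi\in S_n(213)$ with first letter $k$, one can write $\pi=k\,\pi'\,\pi''$ with $\pi'$ a permutation of $\{k+1,\dots,n\}$ and $\pi''$ a permutation of $[k-1]=\{1,\dots,k-1\}$ (either may be empty). Define $$\alpha(\pi)=k\,\phi(\pi'',[k-1])\,\phi(\pi',\{k+1,\dots,n\}).$$ *)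

theory Defs
  imports Main "HOL-Library.Sublist" "HOL-Combinatorics.Multiset_Permutations"
begin

text \<open>Permutations are words in one-line notation, i.e. lists without repeated entries.
  The set of permutations of a finite set \<open>A\<close> is \<^term>\<open>permutations_of_set A\<close>.\<close>

definition order_isomorphic :: "'a::linorder list \<Rightarrow> 'b::linorder list \<Rightarrow> bool" where
  "order_isomorphic xs ys \<longleftrightarrow>
     length xs = length ys \<and>
     (\<forall>i<length xs. \<forall>j<length xs. xs ! i < xs ! j \<longleftrightarrow> ys ! i < ys ! j)"

definition contains_pattern :: "'a::linorder list \<Rightarrow> nat list \<Rightarrow> bool" where
  "contains_pattern \<pi> \<sigma> \<longleftrightarrow> (\<exists>xs. subseq xs \<pi> \<and> order_isomorphic xs \<sigma>)"

definition avoiding_perms :: "nat \<Rightarrow> nat list \<Rightarrow> nat list set" where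
  "avoiding_perms n \<sigma> = {\<pi> \<in> permutations_of_set {1..n}. \<not> contains_pattern \<pi> \<sigma>}"

text \<open>The word is \<open>\<pi>1 @ s\<^sub>1 # \<pi>2\<close> with \<open>s\<^sub>1\<close> its smallest letter, and \<open>i\<close> is the 1-based position
  of \<open>s\<^sub>1\<close>. The list \<open>ts\<close> is 0-based, so \<open>t\<^sub>j\<close> is \<open>ts ! (j - 1)\<close>.
  Only arguments with \<open>finite T\<close> and \<open>card T = length \<pi>\<close> are meaningful.\<close>

function phi :: "'a::linorder list \<Rightarrow> 'a set \<Rightarrow> 'a list" where
  "phi [] T = []"
| "phi (x # xs) T =
     (let \<pi> = x # xs;
          m = length \<pi>;
          s1 = Min (set \<pi>);
          \<pi>1 = takeWhile (\<lambda>y. y \<noteq> s1) \<pi>;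
          \<pi>2 = tl (dropWhile (\<lambda>y. y \<noteq> s1) \<pi>);
          i = length \<pi>1 + 1;
          ts = sorted_list_of_set T;
          T1 = set (take (m - i) ts);
          T2 = set (take (i - 1) (drop (m - i) ts))
      in phi \<pi>2 T1 @ [ts ! (m - 1)] @ phi \<pi>1 T2)"
  by pat_completeness auto
termination
proof (relation "measure (\<lambda>(\<pi>, T). length \<pi>)", goal_cases)
  case 1
  show ?case by simp
next
  case (2 x xs T \<pi> m s1 \<pi>1 \<pi>2 i ts T1 T2)
  have "length (dropWhile (\<lambda>y. y \<noteq> s1) \<pi>) \<le> length \<pi>"
    by (rule length_dropWhile_le)
  with 2 show ?case by auto
next
  case (3 x xs T \<pi> m s1 \<pi>1 \<pi>2 i ts T1 T2)
  have "s1 \<in> set \<pi>"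
    unfolding 3 by (rule Min_in) auto
  then have "length (takeWhile (\<lambda>y. y \<noteq> s1) \<pi>) < length \<pi>"
    by (metis (mono_tags, lifting) length_takeWhile_le nat_less_le set_takeWhileD
        takeWhile_eq_take take_all_iff order_refl)
  with 3 show ?case by auto
qed

text \<open>For a 213-avoiding permutation of \<open>{1..n}\<close> with first letter \<open>k\<close>, all letters larger
  than \<open>k\<close> precede all letters smaller than \<open>k\<close>. The maximal run of letters larger than \<open>k\<close>
  following \<open>k\<close> is then the permutation of \<open>{k + 1..n}\<close>, and what remains is the
  permutation of \<open>{1..k - 1}\<close>.\<close>

definition alpha :: "nat \<Rightarrow> nat list \<Rightarrow> nat list" where
  "alpha n \<pi> =
     (let k = hd \<pi>;
          \<pi>1 = takeWhile (\<lambda>y. k < y) (tl \<pi>);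
          \<pi>2 = dropWhile (\<lambda>y. k < y) (tl \<pi>)
      in k # phi \<pi>2 {1..k - 1} @ phi \<pi>1 {k + 1..n})"

end

theory Submission imports Defs begin

text \<open>A word \<open>xs @ s # ys\<close> with least letter \<open>s\<close> avoids 213 iff \<open>xs\<close> and \<open>ys\<close> do and all letters
  of \<open>xs\<close> lie above those of \<open>ys\<close>; a word \<open>xs @ t # ys\<close> with greatest letter \<open>t\<close> avoids 231 iff
  \<open>xs\<close> and \<open>ys\<close> do and all letters of \<open>xs\<close> lie below those of \<open>ys\<close>. In both cases the letter sets
  of the two parts are determined by their sizes, so the recursion of \<open>\<phi>\<close> matches the two
  decompositions and \<open>\<phi>\<close> is a bijection from the 213-avoiding to the 231-avoiding words.
  Splitting off the first letter \<open>k\<close> puts the larger letters first in the 213 case and the smaller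
  letters first in the 231 case, and \<open>\<alpha>\<close> applies \<open>\<phi>\<close> to each block and swaps the blocks.\<close>

section \<open>Patterns of length three\<close>

declare One_nat_def [simp del] \<comment> \<open>it would rewrite the literal patterns\<close>
declare subseq_Cons2_iff [simp del]

text \<open>A disjunctive replacement for the conditional rule \<open>subseq_Cons2_iff\<close>: when
  \<open>a = x\<close>, an occurrence inside \<open>xs\<close> also puts \<open>b\<close> in
  \<open>xs\<close>, so the disjuncts may overlap harmlessly.\<close>

lemma subseq_pair_Cons:
  "subseq [a, b] (x # xs) \<longleftrightarrow> a = x \<and> b \<in> set xs \<or> subseq [a, b] xs"
  by (auto simp: subseq_Cons2_iff subseq_singleton_left dest: subseq_Cons' split: if_splits)

lemma subseq_triple_Cons:
  "subseq [a, b, c] (x # xs) \<longleftrightarrow> a = x \<and> subseq [b, c] xs \<or> subseq [a, b, c] xs"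
  by (auto simp: subseq_Cons2_iff dest: subseq_Cons' split: if_splits)

lemma subseq_pair_in_set: "subseq [a, b] xs \<Longrightarrow> a \<in> set xs \<and> b \<in> set xs"
  by (induction xs) (auto simp: subseq_pair_Cons)

lemma subseq_pair_append:
  "subseq [a, b] (xs @ ys) \<longleftrightarrow>
     subseq [a, b] xs \<or> a \<in> set xs \<and> b \<in> set ys \<or> subseq [a, b] ys"
  by (induction xs) (auto simp: subseq_pair_Cons)

lemma subseq_triple_append:
  "subseq [a, b, c] (xs @ ys) \<longleftrightarrow>
     subseq [a, b, c] xs \<or> subseq [a, b] xs \<and> c \<in> set ys \<or>
     a \<in> set xs \<and> subseq [b, c] ys \<or> subseq [a, b, c] ys"
  by (induction xs) (auto simp: subseq_triple_Cons subseq_pair_Cons subseq_pair_append)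

text \<open>Deliberately coarse cases, shared by both patterns. If \<open>s\<close> is the minimum
  (for 213) or the maximum (for 231), the two cases naming \<open>s\<close> contradict the order of
  the triple, leaving only the crossing pair \<open>a\<close>, \<open>c\<close>.\<close>

lemma subseq_triple_append_ConsD:
  assumes "subseq [a, b, c] (xs @ s # ys)"
  shows "subseq [a, b, c] xs \<or> subseq [a, b, c] ys \<or> a \<in> set xs \<and> c \<in> set ys \<or>
    a \<in> set xs \<and> c = s \<or> a = s \<and> b \<in> set ys"
  using assms
  by (auto simp: subseq_triple_append subseq_triple_Cons subseq_pair_Cons dest: subseq_pair_in_set)

text \<open>The analogous coarse split for a leading \<open>k\<close>. When \<open>k\<close>
  separates the values of the two blocks, the last three cases are all incompatible with the
  pattern.\<close>

lemma subseq_triple_Cons_appendD: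
  assumes "subseq [a, b, c] (k # xs @ ys)"
  shows "subseq [a, b, c] xs \<or> subseq [a, b, c] ys \<or> a \<in> set xs \<and> c \<in> set ys \<or>
    a = k \<and> b \<in> set xs \<or> a = k \<and> c \<in> set ys"
  using assms
  by (auto simp: subseq_triple_append subseq_pair_append subseq_triple_Cons dest: subseq_pair_in_set)

section \<open>Occurrences of 213 and 231 as explicit triples\<close>

lemma contains_pattern_subseq:
  "contains_pattern xs \<sigma> \<Longrightarrow> subseq xs ys \<Longrightarrow> contains_pattern ys \<sigma>"
  unfolding contains_pattern_def by (meson subseq_order.order_trans)

lemma all_less_Suc_Suc_Suc:
  "(\<forall>i<Suc (Suc (Suc 0)). P i) \<longleftrightarrow> P 0 \<and> P (Suc 0) \<and> P (Suc (Suc 0))"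
  by (auto simp: less_Suc_eq)

lemma order_isomorphic_213:
  "order_isomorphic xs [2, 1, 3 :: nat] \<longleftrightarrow> (\<exists>a b c. xs = [a, b, c] \<and> b < a \<and> a < c)"
proof (cases "length xs = 3")
  case True
  then obtain a b c where "xs = [a, b, c]"
    by (auto simp: numeral_3_eq_3 length_Suc_conv)
  then show ?thesis
    by (auto simp: order_isomorphic_def all_less_Suc_Suc_Suc)
qed (auto simp: order_isomorphic_def)

lemma order_isomorphic_231:
  "order_isomorphic xs [2, 3, 1 :: nat] \<longleftrightarrow> (\<exists>a b c. xs = [a, b, c] \<and> c < a \<and> a < b)"
proof (cases "length xs = 3")
  case True
  then obtain a b c where "xs = [a, b, c]"
    by (auto simp: numeral_3_eq_3 length_Suc_conv)
  then show ?thesis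
    by (auto simp: order_isomorphic_def all_less_Suc_Suc_Suc)
qed (auto simp: order_isomorphic_def)

lemma contains_213_iff:
  "contains_pattern xs [2, 1, 3] \<longleftrightarrow> (\<exists>a b c. subseq [a, b, c] xs \<and> b < a \<and> a < c)"
  unfolding contains_pattern_def order_isomorphic_213 by blast

lemma contains_213I:
  "subseq [a, b, c] xs \<Longrightarrow> b < a \<Longrightarrow> a < c \<Longrightarrow> contains_pattern xs [2, 1, 3]"
  unfolding contains_213_iff by blast

lemma contains_231_iff:
  "contains_pattern xs [2, 3, 1] \<longleftrightarrow> (\<exists>a b c. subseq [a, b, c] xs \<and> c < a \<and> a < b)"
  unfolding contains_pattern_def order_isomorphic_231 by blast

lemma contains_231I:
  "subseq [a, b, c] xs \<Longrightarrow> c < a \<Longrightarrow> a < b \<Longrightarrow> contains_pattern xs [2, 3, 1]"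
  unfolding contains_231_iff by blast

text \<open>The minimum can serve as the letter 1 of the pattern: \<open>a < c\<close> across
  \<open>s\<close> gives the occurrence \<open>a\<close>, \<open>s\<close>, \<open>c\<close>.
  Conversely, an occurrence contained in neither part must have \<open>a\<close> on the left and
  \<open>c\<close> on the right.\<close>

lemma contains_213_min_iff:
  assumes "\<forall>y\<in>set xs \<union> set ys. s < y"
  shows "contains_pattern (xs @ s # ys) [2, 1, 3] \<longleftrightarrow>
    contains_pattern xs [2, 1, 3] \<or> contains_pattern ys [2, 1, 3] \<or>
    (\<exists>a\<in>set xs. \<exists>c\<in>set ys. a < c)" (is "?L \<longleftrightarrow> ?R")
proof
  assume ?L
  then obtain a b c where abc: "subseq [a, b, c] (xs @ s # ys)" "b < a" "a < c"
    unfolding contains_213_iff by blast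
  from subseq_triple_append_ConsD[OF abc(1)] show ?R
    using assms abc(2,3) by (elim disjE) (auto intro: contains_213I dest: order.asym)
next
  assume ?R
  moreover have "subseq [a, s, c] (xs @ s # ys)" if "a \<in> set xs" "c \<in> set ys" for a c
    using that by (simp add: subseq_triple_append subseq_pair_Cons)
  moreover have "subseq xs (xs @ s # ys)" "subseq ys (xs @ s # ys)"
    by (auto intro: subseq_rev_drop_many subseq_drop_many list_emb_Cons)
  ultimately show ?L
    using assms by (meson contains_pattern_subseq contains_213I UnI1 UnI2)
qed

text \<open>Dual to the minimum case: here the maximum \<open>t\<close> plays the letter 3 between
  \<open>a\<close> and \<open>c\<close>.\<close>

lemma contains_231_max_iff:
  assumes "\<forall>y\<in>set xs \<union> set ys. y < t"
  shows "contains_pattern (xs @ t # ys) [2, 3, 1] \<longleftrightarrow>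
    contains_pattern xs [2, 3, 1] \<or> contains_pattern ys [2, 3, 1] \<or>
    (\<exists>a\<in>set xs. \<exists>c\<in>set ys. c < a)" (is "?L \<longleftrightarrow> ?R")
proof
  assume ?L
  then obtain a b c where abc: "subseq [a, b, c] (xs @ t # ys)" "c < a" "a < b"
    unfolding contains_231_iff by blast
  from subseq_triple_append_ConsD[OF abc(1)] show ?R
    using assms abc(2,3) by (elim disjE) (auto intro: contains_231I dest: order.asym)
next
  assume ?R
  moreover have "subseq [a, t, c] (xs @ t # ys)" if "a \<in> set xs" "c \<in> set ys" for a c
    using that by (simp add: subseq_triple_append subseq_pair_Cons)
  moreover have "subseq xs (xs @ t # ys)" "subseq ys (xs @ t # ys)"
    by (auto intro: subseq_rev_drop_many subseq_drop_many list_emb_Cons)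
  ultimately show ?L
    using assms by (meson contains_pattern_subseq contains_231I UnI1 UnI2)
qed

text \<open>An occurrence with \<open>a\<close> in \<open>xs\<close> and \<open>c\<close> in
  \<open>ys\<close> would need \<open>a < c\<close>, but \<open>c < k < a\<close>. Starting at
  \<open>k\<close> fails too: \<open>b\<close> cannot come from \<open>xs\<close>, nor
  \<open>c\<close> from \<open>ys\<close>.\<close>

lemma contains_213_Cons_append_iff:
  assumes "\<forall>x\<in>set xs. k < x" "\<forall>y\<in>set ys. y < k"
  shows "contains_pattern (k # xs @ ys) [2, 1, 3] \<longleftrightarrow>
    contains_pattern xs [2, 1, 3] \<or> contains_pattern ys [2, 1, 3]" (is "?L \<longleftrightarrow> ?R")
proof
  assume ?L
  then obtain a b c where abc: "subseq [a, b, c] (k # xs @ ys)" "b < a" "a < c"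
    unfolding contains_213_iff by blast
  have "\<not> a < c" if "a \<in> set xs" "c \<in> set ys"
    using assms that by (meson order.asym order.strict_trans)
  with subseq_triple_Cons_appendD[OF abc(1)] show ?R
    using assms abc(2,3) by (elim disjE) (auto intro: contains_213I dest: order.asym)
next
  assume ?R
  moreover have "subseq xs (k # xs @ ys)" "subseq ys (k # xs @ ys)"
    by (auto intro: subseq_rev_drop_many subseq_drop_many list_emb_Cons)
  ultimately show ?L
    by (meson contains_pattern_subseq)
qed

lemma contains_231_Cons_append_iff:
  assumes "\<forall>x\<in>set xs. x < k" "\<forall>y\<in>set ys. k < y"
  shows "contains_pattern (k # xs @ ys) [2, 3, 1] \<longleftrightarrow>
    contains_pattern xs [2, 3, 1] \<or> contains_pattern ys [2, 3, 1]" (is "?L \<longleftrightarrow> ?R")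
proof
  assume ?L
  then obtain a b c where abc: "subseq [a, b, c] (k # xs @ ys)" "c < a" "a < b"
    unfolding contains_231_iff by blast
  have "\<not> c < a" if "a \<in> set xs" "c \<in> set ys"
    using assms that by (meson order.asym order.strict_trans)
  with subseq_triple_Cons_appendD[OF abc(1)] show ?R
    using assms abc(2,3) by (elim disjE) (auto intro: contains_231I dest: order.asym)
next
  assume ?R
  moreover have "subseq xs (k # xs @ ys)" "subseq ys (k # xs @ ys)"
    by (auto intro: subseq_rev_drop_many subseq_drop_many list_emb_Cons)
  ultimately show ?L
    by (meson contains_pattern_subseq)
qed

text \<open>The remainder starts with some \<open>b < k\<close>; a later \<open>c > k\<close> would
  complete the 213 occurrence \<open>k\<close>, \<open>b\<close>, \<open>c\<close>. So the larger
  letters form one run right after \<open>k\<close>.\<close>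

lemma dropWhile_greater_213:
  assumes "\<not> contains_pattern (k # zs) [2, 1, 3]" "k \<notin> set zs"
  shows "\<forall>y\<in>set (dropWhile (\<lambda>y. k < y) zs). y < k"
proof (cases "dropWhile (\<lambda>y. k < y) zs")
  case (Cons b ys)
  have "\<not> k < b"
    using Cons hd_dropWhile[of "\<lambda>y. k < y" zs] by simp
  moreover have "set (b # ys) \<subseteq> set zs"
    unfolding Cons[symmetric] by (auto dest: set_dropWhileD)
  ultimately have "b < k" "k \<notin> set ys"
    using assms(2) by (auto simp: not_less order_le_less)
  moreover have "\<not> k < c" if "c \<in> set ys" for c
  proof
    assume "k < c"
    have "subseq [b, c] (takeWhile (\<lambda>y. k < y) zs @ dropWhile (\<lambda>y. k < y) zs)"
      unfolding Cons using that by (simp add: subseq_pair_append subseq_pair_Cons)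
    then have "subseq [k, b, c] (k # zs)"
      by (simp add: subseq_triple_Cons)
    then show False
      using assms(1) \<open>b < k\<close> \<open>k < c\<close> unfolding contains_213_iff by blast
  qed
  ultimately show ?thesis
    using Cons by (auto simp: not_less_iff_gr_or_eq)
next
  case Nil
  show ?thesis
    unfolding Nil by simp
qed

text \<open>Here the remainder starts with some \<open>b > k\<close>, and a later
  \<open>c < k\<close> would make \<open>k\<close>, \<open>b\<close>, \<open>c\<close> a
  231.\<close>

lemma dropWhile_less_231:
  assumes "\<not> contains_pattern (k # zs) [2, 3, 1]" "k \<notin> set zs"
  shows "\<forall>y\<in>set (dropWhile (\<lambda>y. y < k) zs). k < y"
proof (cases "dropWhile (\<lambda>y. y < k) zs")
  case (Cons b ys)
  have "\<not> b < k"
    using Cons hd_dropWhile[of "\<lambda>y. y < k" zs] by simp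
  moreover have "set (b # ys) \<subseteq> set zs"
    unfolding Cons[symmetric] by (auto dest: set_dropWhileD)
  ultimately have "k < b" "k \<notin> set ys"
    using assms(2) by (auto simp: not_less order_le_less)
  moreover have "\<not> c < k" if "c \<in> set ys" for c
  proof
    assume "c < k"
    have "subseq [b, c] (takeWhile (\<lambda>y. y < k) zs @ dropWhile (\<lambda>y. y < k) zs)"
      unfolding Cons using that by (simp add: subseq_pair_append subseq_pair_Cons)
    then have "subseq [k, b, c] (k # zs)"
      by (simp add: subseq_triple_Cons)
    then show False
      using assms(1) \<open>k < b\<close> \<open>c < k\<close> unfolding contains_231_iff by blast
  qed
  ultimately show ?thesis
    using Cons by (auto simp: not_less_iff_gr_or_eq)
next
  case Nil
  show ?thesis
    unfolding Nil by simp
qed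

section \<open>Splitting finite sets by size\<close>

definition below :: "'a::linorder set \<Rightarrow> 'a set \<Rightarrow> bool" where
  "below A B \<longleftrightarrow> (\<forall>a\<in>A. \<forall>b\<in>B. a < b)"

lemma sorted_list_of_set_Un_below:
  assumes "finite A" "finite B" "below A B"
  shows "sorted_list_of_set (A \<union> B) = sorted_list_of_set A @ sorted_list_of_set B"
proof -
  have "distinct (sorted_list_of_set A @ sorted_list_of_set B)"
    "sorted (sorted_list_of_set A @ sorted_list_of_set B)"
    using assms by (auto simp: sorted_append below_def less_imp_le)
  then show ?thesis
    using assms(1,2) by (intro sorted_distinct_set_unique) auto
qed

text \<open>Both splits cut the same sorted list, and equal cardinalities put the cut at the same
  place.\<close>

lemma below_split_unique:
  assumes "finite (A \<union> B)" "A \<union> B = C \<union> D" "below A B" "below C D" "card A = card C"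
  shows "A = C" "B = D"
proof -
  have fin: "finite A" "finite B" "finite C" "finite D"
    using assms(1) assms(1)[unfolded assms(2)] by simp_all
  then have "sorted_list_of_set A @ sorted_list_of_set B =
      sorted_list_of_set C @ sorted_list_of_set D"
    using assms by (simp flip: sorted_list_of_set_Un_below)
  then have "sorted_list_of_set A = sorted_list_of_set C"
    "sorted_list_of_set B = sorted_list_of_set D"
    using assms(5) by simp_all
  then show "A = C" "B = D"
    using fin by (metis set_sorted_list_of_set)+
qed

lemma below_split_exists:
  fixes S :: "'a::linorder set"
  assumes "finite S" "card S = p + q"
  obtains A B where "S = A \<union> B" "below A B" "card A = p" "card B = q" "finite A" "finite B"
proof
  let ?l = "sorted_list_of_set S"
  have l: "length ?l = p + q" "sorted_wrt (<) ?l" "set ?l = S"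
    using assms by auto
  have "sorted_wrt (<) (take p ?l @ drop p ?l)"
    using l by simp
  then show "below (set (take p ?l)) (set (drop p ?l))"
    unfolding sorted_wrt_append below_def by blast
  show "S = set (take p ?l) \<union> set (drop p ?l)"
    using l by (metis append_take_drop_id set_append)
  show "card (set (take p ?l)) = p" "card (set (drop p ?l)) = q"
    using l by (simp_all add: distinct_card)
qed simp_all

section \<open>The map \<open>\<phi>\<close>\<close>

text \<open>Trades the index arithmetic of \<open>phi\<close> for order conditions. The sorted list
  of the value set is that of \<open>A\<close>, then that of \<open>B\<close>, then
  \<open>t\<close>; since m - i is \<open>length ys\<close> and i - 1 is \<open>length xs\<close>,
  the two slices are exactly \<open>A\<close> and \<open>B\<close>.\<close>

lemma phi_append_Cons:
  assumes "\<forall>y\<in>set xs \<union> set ys. s < y"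
    and "finite A" "finite B" "below A B" "below (A \<union> B) {t}"
    and "card A = length ys" "card B = length xs"
  shows "phi (xs @ s # ys) (A \<union> B \<union> {t}) = phi ys A @ t # phi xs B"
proof -
  let ?l = "xs @ s # ys" and ?T = "A \<union> B \<union> {t}"
  have s: "Min (set ?l) = s"
    using assms(1) by (intro Min_eqI) (auto simp: ball_Un intro: less_imp_le)
  have ts: "sorted_list_of_set ?T = sorted_list_of_set A @ sorted_list_of_set B @ [t]"
    using assms by (simp add: sorted_list_of_set_Un_below del: Un_insert_right)
  have neq: "\<And>y. y \<in> set xs \<Longrightarrow> y \<noteq> s"
    using assms(1) by blast
  have tw: "takeWhile (\<lambda>y. y \<noteq> s) ?l = xs" "tl (dropWhile (\<lambda>y. y \<noteq> s) ?l) = ys"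
    using neq by (simp_all add: takeWhile_append2 dropWhile_append2)
  \<comment> \<open>The recursive equation of \<open>phi\<close> matches only a visible cons, so the
    word is renamed for one unfolding and then folded back.\<close>
  obtain z zs where z: "?l = z # zs"
    by (cases ?l) auto
  show ?thesis
    using assms(2,3,6,7) unfolding z phi.simps(2) Let_def
    unfolding z[symmetric] s tw ts by (simp add: nth_append)
qed

section \<open>Cutting words and value sets at an extreme element\<close>

lemma split_at_Min:
  assumes "distinct zs" "zs \<noteq> []"
  obtains xs ys where "zs = xs @ Min (set zs) # ys" "\<forall>y\<in>set xs \<union> set ys. Min (set zs) < y"
proof -
  have "Min (set zs) \<in> set zs"
    using assms by simp
  then obtain xs ys where zs: "zs = xs @ Min (set zs) # ys"
    by (meson split_list)
  have "Min (set zs) < y" if "y \<in> set xs \<union> set ys" for y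
  proof -
    have "y \<in> set zs"
      by (subst zs) (use that in auto)
    moreover have "Min (set zs) \<notin> set xs \<union> set ys"
      using assms(1) by (subst (asm) zs) auto
    ultimately show ?thesis
      using that by (metis List.finite_set Min_le order_le_imp_less_or_eq)
  qed
  with zs show thesis
    using that by blast
qed

lemma split_at_Max:
  assumes "distinct zs" "zs \<noteq> []"
  obtains xs ys where "zs = xs @ Max (set zs) # ys" "\<forall>y\<in>set xs \<union> set ys. y < Max (set zs)"
proof -
  have "Max (set zs) \<in> set zs"
    using assms by simp
  then obtain xs ys where zs: "zs = xs @ Max (set zs) # ys"
    by (meson split_list)
  have "y < Max (set zs)" if "y \<in> set xs \<union> set ys" for y
  proof -
    have "y \<in> set zs"
      by (subst zs) (use that in auto)
    moreover have "Max (set zs) \<notin> set xs \<union> set ys"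
      using assms(1) by (subst (asm) zs) auto
    ultimately show ?thesis
      using that by (metis List.finite_set Max_ge order_le_imp_less_or_eq)
  qed
  with zs show thesis
    using that by blast
qed

text \<open>Supplies the value sets required by \<open>phi_append_Cons\<close>: remove the maximum,
  then cut the rest by size.\<close>

lemma top_split_exists:
  fixes T :: "'a::linorder set"
  assumes "finite T" "card T = Suc (p + q)"
  obtains A B where "T = A \<union> B \<union> {Max T}" "below A B" "below (A \<union> B) {Max T}"
    "card A = p" "card B = q" "finite A" "finite B"
proof -
  have "T \<noteq> {}"
    using assms by auto
  have T: "T = (T - {Max T}) \<union> {Max T}"
    using Max_in[OF assms(1) \<open>T \<noteq> {}\<close>] by blast
  have "below (T - {Max T}) {Max T}"
    using assms(1) by (auto simp: below_def order_less_le)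
  have "card (T - {Max T}) = p + q"
    using assms \<open>T \<noteq> {}\<close> by simp
  then obtain A B where "T - {Max T} = A \<union> B" "below A B" "card A = p" "card B = q"
    "finite A" "finite B"
    using below_split_exists[of "T - {Max T}" p q] assms(1) by (metis finite_Diff)
  with T \<open>below (T - {Max T}) {Max T}\<close> show thesis
    using that by metis
qed

text \<open>Avoidance is forced by how \<open>phi\<close> distributes values: at each level the
  smaller ones go left of the maximum and the larger ones right, so by
  \<open>contains_231_max_iff\<close> no occurrence arises outside the two recursive words.\<close>

lemma phi_perm_avoids_231:
  assumes "distinct \<pi>" "finite T" "card T = length \<pi>"
  shows "distinct (phi \<pi> T) \<and> set (phi \<pi> T) = T \<and> \<not> contains_pattern (phi \<pi> T) [2, 3, 1]"
  using assms
proof (induction \<pi> arbitrary: T rule: length_induct)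
  case (1 \<pi>)
  show ?case
  proof (cases "\<pi> = []")
    case True
    with 1 show ?thesis
      by (simp add: contains_231_iff)
  next
    case False
    then obtain s xs ys where \<pi>: "\<pi> = xs @ s # ys" and s: "\<forall>y\<in>set xs \<union> set ys. s < y"
      using split_at_Min "1.prems"(1) by metis
    define t where "t = Max T"
    obtain A B where T: "T = A \<union> B \<union> {t}" "below A B" "below (A \<union> B) {t}"
      "card A = length ys" "card B = length xs" "finite A" "finite B"
      using top_split_exists[of T "length ys" "length xs"] "1.prems" \<pi>
      by (auto simp: add.commute t_def)
    have IH: "distinct (phi ys A) \<and> set (phi ys A) = A \<and> \<not> contains_pattern (phi ys A) [2, 3, 1]"
      "distinct (phi xs B) \<and> set (phi xs B) = B \<and> \<not> contains_pattern (phi xs B) [2, 3, 1]"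
      using 1 \<pi> T by auto
    have "phi \<pi> T = phi ys A @ t # phi xs B"
      using phi_append_Cons s T \<pi> by metis
    moreover have "A \<inter> B = {}" "t \<notin> A \<union> B" "\<forall>y\<in>A \<union> B. y < t" "\<forall>a\<in>A. \<forall>b\<in>B. \<not> b < a"
      using T(2,3) by (fastforce simp: below_def)+
    ultimately show ?thesis
      using IH T(1) by (auto simp: contains_231_max_iff)
  qed
qed

text \<open>The position of the maximum in the common image reveals the sizes of both parts of
  either preimage. Avoiding 213 then fixes their letter sets, and induction applies to each
  part.\<close>

lemma phi_inj:
  assumes "distinct \<pi>" "distinct \<rho>" "set \<pi> = set \<rho>" "finite T" "card T = length \<pi>"
    and "\<not> contains_pattern \<pi> [2, 1, 3]" "\<not> contains_pattern \<rho> [2, 1, 3]"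
    and "phi \<pi> T = phi \<rho> T"
  shows "\<pi> = \<rho>"
  using assms
proof (induction \<pi> arbitrary: \<rho> T rule: length_induct)
  case (1 \<pi>)
  show ?case
  proof (cases "\<pi> = []")
    case True
    with 1 show ?thesis
      by simp
  next
    case False
    with "1.prems"(3) have "\<rho> \<noteq> []"
      by auto
    define s where "s = Min (set \<pi>)"
    obtain xs ys where \<pi>: "\<pi> = xs @ s # ys" and s: "\<forall>y\<in>set xs \<union> set ys. s < y"
      using split_at_Min[OF "1.prems"(1) False] unfolding s_def by metis
    obtain us vs where \<rho>: "\<rho> = us @ s # vs" and s': "\<forall>y\<in>set us \<union> set vs. s < y"
      using split_at_Min[OF "1.prems"(2) \<open>\<rho> \<noteq> []\<close>] unfolding s_def "1.prems"(3) by metis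
    have len: "length \<pi> = length \<rho>"
      using "1.prems"(1-3) by (metis distinct_card)
    obtain A B where T: "T = A \<union> B \<union> {Max T}" "below A B" "below (A \<union> B) {Max T}"
      "card A = length ys" "card B = length xs" "finite A" "finite B"
      using top_split_exists[of T "length ys" "length xs"] "1.prems" \<pi> by (auto simp: add.commute)
    \<comment> \<open>\<open>C\<close> and \<open>D\<close> are sized by the cut of the second word;
      that they equal \<open>A\<close> and \<open>B\<close> is known only once the images have been
      compared.\<close>
    obtain C D where T': "T = C \<union> D \<union> {Max T}" "below C D" "below (C \<union> D) {Max T}"
      "card C = length vs" "card D = length us" "finite C" "finite D"
      using top_split_exists[of T "length vs" "length us"] "1.prems" \<rho> len by (auto simp: add.commute)
    have "phi \<pi> T = phi ys A @ Max T # phi xs B"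
      using phi_append_Cons s T \<pi> by metis
    moreover have "phi \<rho> T = phi vs C @ Max T # phi us D"
      using phi_append_Cons s' T' \<rho> by metis
    moreover have sets: "set (phi ys A) = A" "set (phi xs B) = B" "set (phi vs C) = C" "set (phi us D) = D"
      using phi_perm_avoids_231 T T' "1.prems"(1,2) \<pi> \<rho> by auto
    \<comment> \<open>The maximum occurs only once in the image, so the two decompositions around it
      must coincide.\<close>
    moreover have "Max T \<notin> A" "Max T \<notin> B"
      using T(3) by (auto simp: below_def)
    ultimately have eq: "phi ys A = phi vs C" "phi xs B = phi us D"
      using "1.prems"(8) append_Cons_eq_iff[of "Max T" "phi ys A" "phi xs B" "phi vs C" "phi us D"]
      by simp_all
    with sets have AC: "A = C" "B = D"
      by auto
    have avoid: "\<not> contains_pattern xs [2, 1, 3]" "\<not> contains_pattern ys [2, 1, 3]"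
      "\<not> contains_pattern us [2, 1, 3]" "\<not> contains_pattern vs [2, 1, 3]"
      and ord: "\<forall>a\<in>set xs. \<forall>c\<in>set ys. \<not> a < c" "\<forall>a\<in>set us. \<forall>c\<in>set vs. \<not> a < c"
      using "1.prems"(6,7) s s' unfolding \<pi> \<rho> by (simp_all add: contains_213_min_iff)
    have dist: "distinct xs" "distinct ys" "distinct us" "distinct vs"
      "s \<notin> set xs \<union> set ys" "s \<notin> set us \<union> set vs"
      "set xs \<inter> set ys = {}" "set us \<inter> set vs = {}"
      using "1.prems"(1,2) \<pi> \<rho> by auto
    have "set ys \<union> set xs = set vs \<union> set us"
      using "1.prems"(3) dist unfolding \<pi> \<rho> by auto
    \<comment> \<open>In a 213-avoider the letters right of the minimum lie below those left of it,
      so the lower set comes from the right part.\<close>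
    moreover have "below (set ys) (set xs)" "below (set vs) (set us)"
      using ord dist(7,8) unfolding below_def by (metis disjoint_iff linorder_cases)+
    moreover have "card (set ys) = card (set vs)"
      using dist T T' AC by (simp add: distinct_card)
    ultimately have "set ys = set vs" "set xs = set us"
      using below_split_unique[of "set ys" "set xs" "set vs" "set us"] by auto
    then have "ys = vs" "xs = us"
      using "1.IH" \<pi> dist avoid eq AC T by auto
    then show ?thesis
      using \<pi> \<rho> by simp
  qed
qed

text \<open>The preimage is assembled by reversing the recursion: cut \<tau> at its maximum, split
  \<open>S\<close> without its minimum into blocks of matching sizes, and take preimages of the
  parts by induction.\<close>

lemma phi_surj:
  fixes S T :: "'a::linorder set"
  assumes "distinct \<tau>" "\<not> contains_pattern \<tau> [2, 3, 1]" "finite S" "card S = length \<tau>"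
  shows "\<exists>\<pi>. distinct \<pi> \<and> set \<pi> = S \<and> \<not> contains_pattern \<pi> [2, 1, 3] \<and> phi \<pi> (set \<tau>) = \<tau>"
  using assms
proof (induction \<tau> arbitrary: S rule: length_induct)
  case (1 \<tau>)
  show ?case
  proof (cases "\<tau> = []")
    case True
    with 1 show ?thesis
      by (intro exI[of _ "[]"]) (simp add: contains_213_iff)
  next
    case False
    then obtain t xs ys where \<tau>: "\<tau> = xs @ t # ys" and t: "\<forall>y\<in>set xs \<union> set ys. y < t"
      using split_at_Max "1.prems"(1) by metis
    have "S \<noteq> {}"
      using "1.prems" False by auto
    define s where "s = Min S"
    have s: "s \<in> S" "\<And>x. x \<in> S - {s} \<Longrightarrow> s < x"
      using "1.prems"(3) \<open>S \<noteq> {}\<close> by (auto simp: s_def order_less_le)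
    have "card (S - {s}) = length xs + length ys"
      using "1.prems" s \<tau> by simp
    \<comment> \<open>\<open>A\<close>, the lower block, is sized for \<open>xs\<close> because
      \<open>phi\<close> turns the part right of the minimum into the part left of the maximum. The
      preimage will thus be \<open>vs @ s # us\<close> with letters \<open>A\<close> in
      \<open>us\<close>, the order that avoids 213.\<close>
    then obtain A B where S: "S - {s} = A \<union> B" "below A B" "card A = length xs"
      "card B = length ys" "finite A" "finite B"
      using below_split_exists[of "S - {s}"] "1.prems"(3) by (metis finite_Diff)
    have avoid: "\<not> contains_pattern xs [2, 3, 1]" "\<not> contains_pattern ys [2, 3, 1]"
      and ord: "\<forall>a\<in>set xs. \<forall>c\<in>set ys. \<not> c < a"
      using "1.prems"(2) t unfolding \<tau> by (simp_all add: contains_231_max_iff)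
    obtain us where us: "distinct us" "set us = A" "\<not> contains_pattern us [2, 1, 3]"
      "phi us (set xs) = xs"
      using "1.IH"[rule_format, of xs A] \<tau> S avoid "1.prems"(1) by auto
    obtain vs where vs: "distinct vs" "set vs = B" "\<not> contains_pattern vs [2, 1, 3]"
      "phi vs (set ys) = ys"
      using "1.IH"[rule_format, of ys B] \<tau> S avoid "1.prems"(1) by auto
    have gt: "\<forall>y\<in>set vs \<union> set us. s < y"
      using s S us vs by auto
    have "phi (vs @ s # us) (set xs \<union> set ys \<union> {t}) = phi us (set xs) @ t # phi vs (set ys)"
    proof (rule phi_append_Cons[OF gt])
      show "below (set xs) (set ys)"
        using ord "1.prems"(1) \<tau> by (auto simp: below_def not_less order_le_less)
      show "below (set xs \<union> set ys) {t}"
        using t by (auto simp: below_def)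
      show "card (set xs) = length us" "card (set ys) = length vs"
        using "1.prems"(1) \<tau> S us vs by (metis distinct_append distinct.simps(2) distinct_card)+
    qed simp_all
    then have "phi (vs @ s # us) (set \<tau>) = \<tau>"
      using us vs \<tau> by simp
    moreover have "distinct (vs @ s # us)"
      using us vs S(2) gt by (fastforce simp: below_def)
    moreover have "set (vs @ s # us) = S"
      using us vs S(1) s(1) by auto
    moreover have "\<not> contains_pattern (vs @ s # us) [2, 1, 3]"
      using gt us vs S(2) by (fastforce simp: contains_213_min_iff below_def)
    ultimately show ?thesis
      by blast
  qed
qed

section \<open>The bijection \<phi> between avoidance classes on arbitrary finite letter
  sets\<close>

definition avoiding_perms_of :: "'a::linorder set \<Rightarrow> nat list \<Rightarrow> 'a list set" where
  "avoiding_perms_of S \<sigma> = {\<pi> \<in> permutations_of_set S. \<not> contains_pattern \<pi> \<sigma>}"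

lemma mem_avoiding_perms_of:
  "\<pi> \<in> avoiding_perms_of S \<sigma> \<longleftrightarrow> set \<pi> = S \<and> distinct \<pi> \<and> \<not> contains_pattern \<pi> \<sigma>"
  by (auto simp: avoiding_perms_of_def permutations_of_set_def)

lemma phi_bij:
  assumes "finite S" "finite T" "card S = card T"
  shows "bij_betw (\<lambda>\<pi>. phi \<pi> T) (avoiding_perms_of S [2, 1, 3]) (avoiding_perms_of T [2, 3, 1])"
proof -
  have len: "card T = length \<pi>" if "\<pi> \<in> avoiding_perms_of S \<sigma>" for \<pi> \<sigma>
    using that assms(3) by (metis distinct_card mem_avoiding_perms_of)
  have "inj_on (\<lambda>\<pi>. phi \<pi> T) (avoiding_perms_of S [2, 1, 3])"
  proof (rule inj_onI)
    fix \<pi> \<rho>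
    assume *: "\<pi> \<in> avoiding_perms_of S [2, 1, 3]" "\<rho> \<in> avoiding_perms_of S [2, 1, 3]"
      "phi \<pi> T = phi \<rho> T"
    then show "\<pi> = \<rho>"
      using phi_inj[of \<pi> \<rho> T] assms(2) len[OF *(1)] by (simp add: mem_avoiding_perms_of)
  qed
  moreover have "phi \<pi> T \<in> avoiding_perms_of T [2, 3, 1]"
    if "\<pi> \<in> avoiding_perms_of S [2, 1, 3]" for \<pi>
    using phi_perm_avoids_231[OF _ assms(2) len[OF that]] that by (simp add: mem_avoiding_perms_of)
  moreover have "\<tau> \<in> (\<lambda>\<pi>. phi \<pi> T) ` avoiding_perms_of S [2, 1, 3]"
    if "\<tau> \<in> avoiding_perms_of T [2, 3, 1]" for \<tau>
  proof -
    have "set \<tau> = T" "distinct \<tau>" "\<not> contains_pattern \<tau> [2, 3, 1]" "card S = length \<tau>"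
      using that assms(3) distinct_card by (auto simp: mem_avoiding_perms_of)
    then obtain \<pi> where "distinct \<pi>" "set \<pi> = S" "\<not> contains_pattern \<pi> [2, 1, 3]" "phi \<pi> T = \<tau>"
      using phi_surj[of \<tau> S] assms(1) by auto
    then show ?thesis
      by (intro image_eqI[of _ _ \<pi>]) (simp_all add: mem_avoiding_perms_of)
  qed
  ultimately show ?thesis
    unfolding bij_betw_def by blast
qed

section \<open>The map \<open>\<alpha>\<close>\<close>

text \<open>The run of letters exceeding \<open>k\<close> and its remainder, the same cut as in
  \<open>alpha\<close>, provide the blocks; their letter sets follow by comparing the elements of
  \<open>{1..n}\<close> with \<open>k\<close>.\<close>

lemma avoiding_perms_213_split:
  assumes "n \<ge> 1" "\<pi> \<in> avoiding_perms n [2, 1, 3]"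
  obtains k xs ys where "k \<in> {1..n}" "\<pi> = k # xs @ ys"
    "xs \<in> avoiding_perms_of {k + 1..n} [2, 1, 3]" "ys \<in> avoiding_perms_of {1..k - 1} [2, 1, 3]"
proof -
  have \<pi>: "set \<pi> = {1..n}" "distinct \<pi>" "\<not> contains_pattern \<pi> [2, 1, 3]"
    using assms(2) by (auto simp: avoiding_perms_def permutations_of_set_def)
  then obtain k zs where kz: "\<pi> = k # zs"
    using assms(1) by (cases \<pi>) auto
  define xs ys where "xs = takeWhile (\<lambda>y. k < y) zs" and "ys = dropWhile (\<lambda>y. k < y) zs"
  have zs: "zs = xs @ ys"
    by (simp add: xs_def ys_def)
  have gt: "\<forall>x\<in>set xs. k < x"
    by (auto simp: xs_def dest: set_takeWhileD)
  have lt: "\<forall>y\<in>set ys. y < k"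
    using dropWhile_greater_213[of k zs] \<pi> kz by (simp add: ys_def)
  have un: "insert k (set xs \<union> set ys) = {1..n}"
    using \<pi> kz zs by auto
  have "k \<in> {1..n}" "\<pi> = k # xs @ ys"
    using un kz zs by auto
  moreover have "set xs = {k + 1..n}"
  proof -
    have "set xs = {x \<in> insert k (set xs \<union> set ys). k < x}"
      using gt lt by auto
    also have "\<dots> = {k + 1..n}"
      unfolding un by auto
    finally show ?thesis .
  qed
  moreover have "set ys = {1..k - 1}"
  proof -
    have "set ys = {x \<in> insert k (set xs \<union> set ys). x < k}"
      using gt lt by auto
    \<comment> \<open>The bound \<open>k\<close> at most \<open>n\<close> keeps this interval inside
      \<open>{1..n}\<close>.\<close>
    also have "\<dots> = {1..k - 1}"
      unfolding un using \<open>k \<in> {1..n}\<close> by auto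
    finally show ?thesis .
  qed
  ultimately show thesis
    using that[of k xs ys] \<pi> gt lt by (auto simp: mem_avoiding_perms_of contains_213_Cons_append_iff)
qed

lemma avoiding_perms_231_split:
  assumes "n \<ge> 1" "\<pi> \<in> avoiding_perms n [2, 3, 1]"
  obtains k xs ys where "k \<in> {1..n}" "\<pi> = k # xs @ ys"
    "xs \<in> avoiding_perms_of {1..k - 1} [2, 3, 1]" "ys \<in> avoiding_perms_of {k + 1..n} [2, 3, 1]"
proof -
  have \<pi>: "set \<pi> = {1..n}" "distinct \<pi>" "\<not> contains_pattern \<pi> [2, 3, 1]"
    using assms(2) by (auto simp: avoiding_perms_def permutations_of_set_def)
  then obtain k zs where kz: "\<pi> = k # zs"
    using assms(1) by (cases \<pi>) auto
  define xs ys where "xs = takeWhile (\<lambda>y. y < k) zs" and "ys = dropWhile (\<lambda>y. y < k) zs"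
  have zs: "zs = xs @ ys"
    by (simp add: xs_def ys_def)
  have lt: "\<forall>x\<in>set xs. x < k"
    by (auto simp: xs_def dest: set_takeWhileD)
  have gt: "\<forall>y\<in>set ys. k < y"
    using dropWhile_less_231[of k zs] \<pi> kz by (simp add: ys_def)
  have un: "insert k (set xs \<union> set ys) = {1..n}"
    using \<pi> kz zs by auto
  have "k \<in> {1..n}" "\<pi> = k # xs @ ys"
    using un kz zs by auto
  moreover have "set xs = {1..k - 1}"
  proof -
    have "set xs = {x \<in> insert k (set xs \<union> set ys). x < k}"
      using gt lt by auto
    also have "\<dots> = {1..k - 1}"
      unfolding un using \<open>k \<in> {1..n}\<close> by auto
    finally show ?thesis .
  qed
  moreover have "set ys = {k + 1..n}"
  proof -
    have "set ys = {x \<in> insert k (set xs \<union> set ys). k < x}"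
      using gt lt by auto
    also have "\<dots> = {k + 1..n}"
      unfolding un by auto
    finally show ?thesis .
  qed
  ultimately show thesis
    using that[of k xs ys] \<pi> gt lt by (auto simp: mem_avoiding_perms_of contains_231_Cons_append_iff)
qed

lemma avoiding_perms_213_Cons_append:
  assumes "k \<in> {1..n}"
    and "xs \<in> avoiding_perms_of {k + 1..n} [2, 1, 3]" "ys \<in> avoiding_perms_of {1..k - 1} [2, 1, 3]"
  shows "k # xs @ ys \<in> avoiding_perms n [2, 1, 3]"
proof -
  have "\<forall>x\<in>set xs. k < x" "\<forall>y\<in>set ys. y < k"
    using assms by (auto simp: mem_avoiding_perms_of)
  from contains_213_Cons_append_iff[OF this] show ?thesis
    using assms by (auto simp: avoiding_perms_def permutations_of_set_def mem_avoiding_perms_of)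
qed

lemma avoiding_perms_231_Cons_append:
  assumes "k \<in> {1..n}"
    and "xs \<in> avoiding_perms_of {1..k - 1} [2, 3, 1]" "ys \<in> avoiding_perms_of {k + 1..n} [2, 3, 1]"
  shows "k # xs @ ys \<in> avoiding_perms n [2, 3, 1]"
proof -
  have "\<forall>x\<in>set xs. x < k" "\<forall>y\<in>set ys. k < y"
    using assms by (auto simp: mem_avoiding_perms_of)
  from contains_231_Cons_append_iff[OF this] show ?thesis
    using assms by (auto simp: avoiding_perms_def permutations_of_set_def mem_avoiding_perms_of)
qed

lemma alpha_Cons_append:
  assumes "\<forall>x\<in>set xs. k < x" "\<forall>y\<in>set ys. y < k"
  shows "alpha n (k # xs @ ys) = k # phi ys {1..k - 1} @ phi xs {k + 1..n}"
proof -
  have "takeWhile (\<lambda>y. k < y) ys = []" "dropWhile (\<lambda>y. k < y) ys = ys"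
    using assms(2) by (cases ys; auto)+
  then show ?thesis
    using assms(1) by (simp add: alpha_def Let_def takeWhile_append2 dropWhile_append2)
qed

theorem theorem2p6:
  fixes n :: nat
  assumes "n \<ge> 1"
  shows "bij_betw (alpha n) (avoiding_perms n [2, 1, 3]) (avoiding_perms n [2, 3, 1])"
proof -
  let ?lo = "\<lambda>k. {1..k - 1}" and ?hi = "\<lambda>k. {k + 1..n}"
  have alpha: "alpha n (k # xs @ ys) = k # phi ys (?lo k) @ phi xs (?hi k)"
    if "xs \<in> avoiding_perms_of (?hi k) \<sigma>" "ys \<in> avoiding_perms_of (?lo k) \<sigma>" for k xs ys \<sigma>
    using that by (intro alpha_Cons_append) (auto simp: mem_avoiding_perms_of)
  have bij: "bij_betw (\<lambda>\<pi>. phi \<pi> S) (avoiding_perms_of S [2, 1, 3]) (avoiding_perms_of S [2, 3, 1])"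
    if "finite S" for S :: "nat set"
    using phi_bij that by blast
  note mem = bij_betwE[OF bij, rule_format]
  have "inj_on (alpha n) (avoiding_perms n [2, 1, 3])"
  proof (rule inj_onI)
    fix \<pi> \<rho>
    assume "\<pi> \<in> avoiding_perms n [2, 1, 3]" "\<rho> \<in> avoiding_perms n [2, 1, 3]"
      and eq: "alpha n \<pi> = alpha n \<rho>"
    then obtain k xs ys l us vs
      where \<pi>: "\<pi> = k # xs @ ys" "xs \<in> avoiding_perms_of (?hi k) [2, 1, 3]"
        "ys \<in> avoiding_perms_of (?lo k) [2, 1, 3]"
      and \<rho>: "\<rho> = l # us @ vs" "us \<in> avoiding_perms_of (?hi l) [2, 1, 3]"
        "vs \<in> avoiding_perms_of (?lo l) [2, 1, 3]"
      using avoiding_perms_213_split[OF assms] by metis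
    \<comment> \<open>\<alpha> keeps the first letter, so equal images have equal heads and hence
      the same pair of value intervals.\<close>
    have "l = k" and app: "phi ys (?lo k) @ phi xs (?hi k) = phi vs (?lo k) @ phi us (?hi k)"
      using eq alpha \<pi> \<rho> by auto
    \<comment> \<open>Block lengths are fixed by the intervals, which is what allows the equality of
      concatenations \<open>app\<close> to be split.\<close>
    have "length (phi \<tau> S) = card S"
      if "\<tau> \<in> avoiding_perms_of S [2, 1, 3]" "finite S" for \<tau> and S :: "nat set"
      using mem[OF that(2,1)] by (metis mem_avoiding_perms_of distinct_card)
    then have "length (phi ys (?lo k)) = length (phi vs (?lo k))"
      using \<pi> \<rho> \<open>l = k\<close> by simp
    with app have "phi ys (?lo k) = phi vs (?lo k)" "phi xs (?hi k) = phi us (?hi k)"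
      by simp_all
    then have "ys = vs" "xs = us"
      using \<pi> \<rho> \<open>l = k\<close> bij_betw_imp_inj_on[OF bij] by (auto dest: inj_onD)
    with \<pi> \<rho> \<open>l = k\<close> show "\<pi> = \<rho>"
      by simp
  qed
  moreover have "alpha n \<pi> \<in> avoiding_perms n [2, 3, 1]"
    if "\<pi> \<in> avoiding_perms n [2, 1, 3]" for \<pi>
    using that
  proof (rule avoiding_perms_213_split[OF assms])
    fix k xs ys
    assume *: "k \<in> {1..n}" "\<pi> = k # xs @ ys" "xs \<in> avoiding_perms_of (?hi k) [2, 1, 3]"
      "ys \<in> avoiding_perms_of (?lo k) [2, 1, 3]"
    then show ?thesis
      using avoiding_perms_231_Cons_append[OF *(1) mem mem] alpha by simp
  qed
  moreover have "\<tau> \<in> alpha n ` avoiding_perms n [2, 1, 3]"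
    if "\<tau> \<in> avoiding_perms n [2, 3, 1]" for \<tau>
    using that
  proof (rule avoiding_perms_231_split[OF assms])
    fix k xs ys
    assume *: "k \<in> {1..n}" "\<tau> = k # xs @ ys" "xs \<in> avoiding_perms_of (?lo k) [2, 3, 1]"
      "ys \<in> avoiding_perms_of (?hi k) [2, 3, 1]"
    obtain us where us: "us \<in> avoiding_perms_of (?lo k) [2, 1, 3]" "xs = phi us (?lo k)"
      using *(3) bij_betw_imp_surj_on[OF bij[of "?lo k"]] by auto
    obtain vs where vs: "vs \<in> avoiding_perms_of (?hi k) [2, 1, 3]" "ys = phi vs (?hi k)"
      using *(4) bij_betw_imp_surj_on[OF bij[of "?hi k"]] by auto
    \<comment> \<open>The preimage carries the blocks in the opposite order: \<open>vs\<close>, with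
      the letters above \<open>k\<close>, comes first, and \<alpha> swaps them back.\<close>
    have "\<tau> = alpha n (k # vs @ us)"
      using alpha[OF vs(1) us(1)] * us vs by simp
    then show ?thesis
      using avoiding_perms_213_Cons_append[OF *(1) vs(1) us(1)] by blast
  qed
  ultimately show ?thesis
    unfolding bij_betw_def by blast
qed

end
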